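(* Let $\varepsilon>0$ and let $(u_n)_{n=0}^{\infty}$ be an $\varepsilon$-convex real sequence. Then there exists an $\varepsilon$-convex function $f:\mathbb{R}_+\to\mathbb{R}$ such that $f(n)=u_n$ for all $n\in\mathbb{N}\cup\{0\}$. Moreover, there exists a convex sequence $(v_n)_{n=0}^{\infty}$ such that $(u_n-v_n)_{n=0}^{\infty}$ is a Lipschitz sequence whose Lipschitz modulus is bounded above by $\varepsilon$.
   Context: $\mathbb{N}=\{1,2,\dots\}$ and $\mathbb{R}_+=[0,\infty)$. A real sequence $(u_n)_{n=0}^{\infty}$ is convex if $2u_n\le u_{n-1}+u_{n+1}$ for all $n\in\mathbb{N}$. It is $\varepsilon$-convex if $u_i-u_{i-1}\le u_j-u_{j-1}+\varepsilon$ for all $i,j\in\mathbb{N}$ with $i<j$. A function $f:\mathbb{R}_+\to\mathbb{R}$ is $\varepsilon$-convex if $$f(tx+(1-t)y)\le tf(x)+(1-t)f(y)+\varepsilon\,t(1-t)|y-x|\quad\text{for all }x,y\in\mathbb{R}_+,\ t\in[0,1].$$ A real sequence $(w_n)_{n=0}^{\infty}$ is a Lipschitz sequence if there is $l\ge 0$ with $|w_n-w_m|\le l|n-m|$ for all $n,m\in\mathbb{N}\cup\{0\}$; the infimum of all such $l$ is its Lipschitz modulus. *)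

theory Defs
  imports "HOL-Analysis.Analysis"
begin

definition convex_seq :: "(nat \<Rightarrow> real) \<Rightarrow> bool" where
  "convex_seq u \<longleftrightarrow> (\<forall>n\<ge>1. 2 * u n \<le> u (n - 1) + u (n + 1))"

definition eps_convex_seq :: "real \<Rightarrow> (nat \<Rightarrow> real) \<Rightarrow> bool" where
  "eps_convex_seq \<epsilon> u \<longleftrightarrow>
     (\<forall>i j. 1 \<le> i \<longrightarrow> i < j \<longrightarrow> u i - u (i - 1) \<le> u j - u (j - 1) + \<epsilon>)"

(* A function f : R_+ -> R is represented by a total function of type real => real;
   its values on the negative reals are unconstrained. *)
definition eps_convex_fun :: "real \<Rightarrow> (real \<Rightarrow> real) \<Rightarrow> bool" where
  "eps_convex_fun \<epsilon> f \<longleftrightarrow>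
     (\<forall>x\<in>{0..}. \<forall>y\<in>{0..}. \<forall>t\<in>{0..1}.
        f (t * x + (1 - t) * y) \<le> t * f x + (1 - t) * f y + \<epsilon> * t * (1 - t) * \<bar>y - x\<bar>)"

(* The type nat is not in class metric_space, so lipschitz_on does not apply to sequences. *)
definition lipschitz_const :: "(nat \<Rightarrow> real) \<Rightarrow> real \<Rightarrow> bool" where
  "lipschitz_const w l \<longleftrightarrow> l \<ge> 0 \<and> (\<forall>n m. \<bar>w n - w m\<bar> \<le> l * \<bar>real n - real m\<bar>)"

definition lipschitz_seq :: "(nat \<Rightarrow> real) \<Rightarrow> bool" where
  "lipschitz_seq w \<longleftrightarrow> (\<exists>l. lipschitz_const w l)"

(* Meaningful only for Lipschitz sequences: otherwise this is Inf of the empty set of reals. *)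
definition lipschitz_modulus :: "(nat \<Rightarrow> real) \<Rightarrow> real" where
  "lipschitz_modulus w = Inf {l. lipschitz_const w l}"

end

theory Submission
  imports Defs
begin

text \<open>
  Both claims follow from one decomposition \<open>u = v + w\<close> with \<open>v\<close> convex and \<open>w\<close> Lipschitz
  with constant \<open>\<epsilon>/2\<close>.  The increments \<open>d\<^sub>n = u\<^sub>n\<^sub>+\<^sub>1 - u\<^sub>n\<close> drop by at most \<open>\<epsilon>\<close> from an earlier to a
  later index, so their running maximum \<open>M\<^sub>n\<close> satisfies \<open>d\<^sub>n \<le> M\<^sub>n \<le> d\<^sub>n + \<epsilon>\<close>.  Hence
  \<open>M\<^sub>n - \<epsilon>/2\<close> is nondecreasing and within \<open>\<epsilon>/2\<close> of \<open>d\<^sub>n\<close>, and its partial sums serve as \<open>v\<close>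
  (lemma \<open>eps_convex_seq_decomposition\<close>).

  For the function, \<open>v\<close> and \<open>w\<close> are extended to the half-line separately: \<open>v\<close> by the supremum of
  its supporting lines, which is convex (\<open>convex_seq_extension\<close>), and \<open>w\<close> by the infimum
  of the cones with vertex on its graph, which keeps the Lipschitz constant
  (\<open>lipschitz_extension_real\<close>).  The constant \<open>\<epsilon>/2\<close> is what makes the sum
  \<open>\<epsilon>\<close>-convex: at \<open>z = t x + (1 - t) y\<close> the distances to \<open>x\<close> and \<open>y\<close> are
  \<open>(1 - t) \<bar>y - x\<bar>\<close> and \<open>t \<bar>y - x\<bar>\<close>, so the Lipschitz part exceeds its chord by at most
  \<open>2 (\<epsilon>/2) t (1 - t) \<bar>y - x\<bar>\<close>.
\<close>

lemma lipschitz_const_if_steps: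
  assumes steps: "\<And>n. \<bar>w (Suc n) - w n\<bar> \<le> L"
  shows "lipschitz_const w L"
proof -
  have forward: "\<bar>w (m + k) - w m\<bar> \<le> L * real k" for m k
  proof (induction k)
    case (Suc k)
    then show ?case using steps[of "m + k"] by (simp add: algebra_simps)
  qed simp
  have ordered: "\<bar>w n - w m\<bar> \<le> L * \<bar>real n - real m\<bar>" if "m \<le> n" for n m
    using forward[of m "n - m"] that by (simp add: of_nat_diff)
  have "\<bar>w n - w m\<bar> \<le> L * \<bar>real n - real m\<bar>" for n m
    using ordered[of m n] ordered[of n m] by (cases "m \<le> n") (auto simp: abs_minus_commute)
  moreover have "0 \<le> L" using steps[of 0] by linarith
  ultimately show ?thesis unfolding lipschitz_const_def by blast
qed

lemma lipschitz_modulus_le: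
  assumes "lipschitz_const w L"
  shows "lipschitz_modulus w \<le> L"
  unfolding lipschitz_modulus_def
proof (rule cInf_lower)
  show "L \<in> {l. lipschitz_const w l}" using assms by simp
  show "bdd_below {l. lipschitz_const w l}"
    by (rule bdd_belowI[of _ 0]) (simp add: lipschitz_const_def)
qed

lemma eps_convex_seq_decomposition:
  assumes "eps_convex_seq \<epsilon> u" and "0 \<le> \<epsilon>"
  obtains v where "convex_seq v" and "lipschitz_const (\<lambda>n. u n - v n) (\<epsilon> / 2)"
proof -
  define d where "d n = u (Suc n) - u n" for n
  define M where "M n = Max (d ` {..n})" for n
  define v where "v n = (\<Sum>i<n. M i - \<epsilon> / 2)" for n
  have v_step: "v (Suc n) - v n = M n - \<epsilon> / 2" for n
    by (simp add: v_def)
  have d_drop: "d i \<le> d j + \<epsilon>" if "i \<le> j" for i j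
  proof (cases "i = j")
    case False
    with that have "1 \<le> Suc i" "Suc i < Suc j" by auto
    then have "u (Suc i) - u (Suc i - 1) \<le> u (Suc j) - u (Suc j - 1) + \<epsilon>"
      using assms(1) unfolding eps_convex_seq_def by blast
    then show ?thesis by (simp add: d_def)
  qed (use assms(2) in simp)
  have M_mono: "M n \<le> M (Suc n)" for n
    unfolding M_def by (rule Max_mono) auto
  have "d n \<le> M n" for n
    unfolding M_def by (rule Max_ge) auto
  moreover have "M n \<le> d n + \<epsilon>" for n
    unfolding M_def using d_drop by (subst Max_le_iff) auto
  ultimately have M_close: "\<bar>d n - (M n - \<epsilon> / 2)\<bar> \<le> \<epsilon> / 2" for n
    by (smt (verit) field_sum_of_halves)
  have "convex_seq v"
    unfolding convex_seq_def
  proof (intro allI impI)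
    fix n :: nat
    assume "1 \<le> n"
    then obtain k where "n = Suc k" by (cases n) auto
    then show "2 * v n \<le> v (n - 1) + v (n + 1)"
      using v_step[of k] v_step[of "Suc k"] M_mono[of k] by simp
  qed
  moreover have "lipschitz_const (\<lambda>n. u n - v n) (\<epsilon> / 2)"
  proof (rule lipschitz_const_if_steps)
    fix n
    show "\<bar>(u (Suc n) - v (Suc n)) - (u n - v n)\<bar> \<le> \<epsilon> / 2"
      using M_close[of n] v_step[of n] d_def[of n] by linarith
  qed
  ultimately show thesis by (rule that)
qed

lemma convex_seq_above_support_line:
  assumes "convex_seq v"
  shows "v n + (v (Suc n) - v n) * (real m - real n) \<le> v m"
proof -
  have "v (Suc k) - v k \<le> v (Suc (Suc k)) - v (Suc k)" for k
    using assms[unfolded convex_seq_def, rule_format, of "Suc k"] by simp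
  then have slopes: "v (Suc i) - v i \<le> v (Suc j) - v j" if "i \<le> j" for i j
    using that by (rule lift_Suc_mono_le[where f = "\<lambda>k. v (Suc k) - v k"])
  show ?thesis
  proof (cases "n \<le> m")
    case True
    then show ?thesis
    proof (induction m rule: dec_induct)
      case (step m)
      then show ?case using slopes[of n m] by (simp add: algebra_simps)
    qed simp
  next
    case False
    then have "m \<le> n" by simp
    then show ?thesis
    proof (induction m rule: inc_induct)
      case (step m)
      then show ?case using slopes[of m n] by (simp add: algebra_simps)
    qed simp
  qed
qed

text \<open>
  The extension is the supremum of the supporting lines.  It is finite because over \<open>[0, m]\<close> each
  line stays below the larger of its two endpoint values, which are at most \<open>v 0\<close> and \<open>v m\<close>.
\<close>

lemma convex_seq_extension:
  assumes "convex_seq v"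
  obtains g :: "real \<Rightarrow> real" where "convex_on {0..} g" and "\<And>n. g (real n) = v n"
proof -
  define line where "line n x = v n + (v (Suc n) - v n) * (x - real n)" for n and x :: real
  define g where "g x = (SUP n. line n x)" for x
  have below: "line n (real m) \<le> v m" for n m
    unfolding line_def by (rule convex_seq_above_support_line[OF assms])
  have affine: "line n (t * x + (1 - t) * y) = t * line n x + (1 - t) * line n y" for n t x y
    by (simp add: line_def algebra_simps)
  have bdd: "bdd_above (range (\<lambda>n. line n x))" if "0 \<le> x" for x
  proof -
    obtain m where m: "x \<le> real m" using real_arch_simple by blast
    have "line n x \<le> max (v 0) (v m)" for n
    proof (cases "0 \<le> v (Suc n) - v n")
      case True
      then have "line n x \<le> line n (real m)"
        unfolding line_def using m by (intro add_left_mono mult_left_mono) auto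
      then show ?thesis using below[of n m] by linarith
    next
      case False
      then have "line n x \<le> line n (real 0)"
        unfolding line_def using that by (intro add_left_mono mult_left_mono_neg) auto
      then show ?thesis using below[of n 0] by linarith
    qed
    then show ?thesis by (rule bdd_aboveI2)
  qed
  have le_g: "line n x \<le> g x" if "0 \<le> x" for n x
    unfolding g_def by (rule cSUP_upper[OF UNIV_I bdd[OF that]])
  have "convex_on {0..} g"
  proof (rule convex_onI)
    fix t x y :: real
    assume t: "0 < t" "t < 1" and xy: "x \<in> {0..}" "y \<in> {0..}"
    have "line n ((1 - t) * x + t * y) \<le> (1 - t) * g x + t * g y" for n
      using affine[of n "1 - t" x y] t xy le_g[of x n] le_g[of y n]
      by (auto intro: add_mono mult_left_mono)
    then show "g ((1 - t) *\<^sub>R x + t *\<^sub>R y) \<le> (1 - t) * g x + t * g y"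
      by (auto simp: g_def[of "(1 - t) * x + t * y"] intro: cSUP_least)
  qed simp
  moreover have "g (real n) = v n" for n
  proof (rule antisym)
    show "g (real n) \<le> v n" unfolding g_def using below by (auto intro: cSUP_least)
    show "v n \<le> g (real n)" using le_g[of "real n" n] by (simp add: line_def)
  qed
  ultimately show thesis by (rule that)
qed

text \<open>
  McShane's extension, with the data given as values \<open>w i\<close> at points \<open>p i\<close>: the infimum of the
  cones \<open>w i + L * dist x (p i)\<close>.  Each cone is Lipschitz with constant \<open>L\<close>, and by hypothesis
  none of them passes below a prescribed value.
\<close>

lemma lipschitz_extension_real:
  fixes p :: "'i \<Rightarrow> 'a::metric_space" and w :: "'i \<Rightarrow> real"
  assumes lip: "\<And>i j. \<bar>w i - w j\<bar> \<le> L * dist (p i) (p j)" and "0 \<le> L"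
  obtains h where "\<And>x y. \<bar>h x - h y\<bar> \<le> L * dist x y" and "\<And>i. h (p i) = w i"
proof -
  define cone where "cone i x = w i + L * dist x (p i)" for i x
  define h where "h x = (INF i. cone i x)" for x
  have cone_lip: "cone i x \<le> cone i y + L * dist x y" for i x y
    using mult_left_mono[OF dist_triangle[of x "p i" y] \<open>0 \<le> L\<close>]
    by (simp add: cone_def algebra_simps)
  have above: "w j \<le> cone i (p j)" for i j
    using lip[of j i] by (simp add: cone_def)
  have bdd: "bdd_below (range (\<lambda>i. cone i x))" for x
  proof (rule bdd_belowI2)
    fix i
    (* The vertex \<open>undefined\<close> is an arbitrary index: any single prescribed value gives a bound. *)
    show "w undefined - L * dist (p undefined) x \<le> cone i x"
      using above[of undefined i] cone_lip[of i "p undefined" x] by linarith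
  qed
  have h_le: "h x \<le> cone i x" for i x
    unfolding h_def by (rule cINF_lower[OF bdd UNIV_I])
  have one_sided: "h x - L * dist x y \<le> h y" for x y
  proof -
    have "h x - L * dist x y \<le> cone i y" for i
      using h_le[of x i] cone_lip[of i x y] by linarith
    then show ?thesis unfolding h_def[of y] by (auto intro: cINF_greatest)
  qed
  have "\<bar>h x - h y\<bar> \<le> L * dist x y" for x y
    using one_sided[of x y] one_sided[of y x] by (simp add: dist_commute abs_le_iff)
  moreover have "h (p i) = w i" for i
  proof (rule antisym)
    show "h (p i) \<le> w i" using h_le[of "p i" i] by (simp add: cone_def)
    show "w i \<le> h (p i)" unfolding h_def using above by (auto intro: cINF_greatest)
  qed
  ultimately show thesis by (rule that)
qed

lemma eps_convex_fun_convex_plus_lipschitz: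
  assumes g: "convex_on {0..} g"
    and h: "\<And>x y. \<bar>h x - h y\<bar> \<le> \<epsilon> / 2 * \<bar>x - y\<bar>"
  shows "eps_convex_fun \<epsilon> (\<lambda>x. g x + h x)"
  unfolding eps_convex_fun_def
proof (intro ballI)
  fix x y t :: real
  assume xy: "x \<in> {0..}" "y \<in> {0..}" and t: "t \<in> {0..1}"
  define z where "z = t * x + (1 - t) * y"
  have g_chord: "g z \<le> t * g x + (1 - t) * g y"
    using convex_onD[OF g, of "1 - t" x y] xy t by (simp add: z_def)
  have "z - x = (1 - t) * (y - x)" "z - y = t * (x - y)"
    by (simp_all add: z_def algebra_simps)
  then have "\<bar>z - x\<bar> = (1 - t) * \<bar>y - x\<bar>" "\<bar>z - y\<bar> = t * \<bar>y - x\<bar>"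
    using t by (simp_all add: abs_mult abs_minus_commute)
  then have near: "h z \<le> h x + \<epsilon> / 2 * ((1 - t) * \<bar>y - x\<bar>)" "h z \<le> h y + \<epsilon> / 2 * (t * \<bar>y - x\<bar>)"
    using abs_le_D1[OF h[of z x]] abs_le_D1[OF h[of z y]] by (simp_all only: diff_le_eq add.commute)
  have "h z = t * h z + (1 - t) * h z" by (simp add: algebra_simps)
  also have "\<dots> \<le> t * (h x + \<epsilon> / 2 * ((1 - t) * \<bar>y - x\<bar>)) + (1 - t) * (h y + \<epsilon> / 2 * (t * \<bar>y - x\<bar>))"
    using near t by (intro add_mono mult_left_mono) auto
  also have "\<dots> = t * h x + (1 - t) * h y + \<epsilon> * t * (1 - t) * \<bar>y - x\<bar>"
    by (simp add: field_simps)
  finally show "g (t * x + (1 - t) * y) + h (t * x + (1 - t) * y)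
      \<le> t * (g x + h x) + (1 - t) * (g y + h y) + \<epsilon> * t * (1 - t) * \<bar>y - x\<bar>"
    using g_chord unfolding z_def by (simp add: algebra_simps)
qed

theorem theorem1p10:
  fixes \<epsilon> :: real and u :: "nat \<Rightarrow> real"
  assumes "\<epsilon> > 0"
    and "eps_convex_seq \<epsilon> u"
  shows "(\<exists>f :: real \<Rightarrow> real. eps_convex_fun \<epsilon> f \<and> (\<forall>n::nat. f (real n) = u n)) \<and>
         (\<exists>v :: nat \<Rightarrow> real. convex_seq v \<and>
            lipschitz_seq (\<lambda>n. u n - v n) \<and> lipschitz_modulus (\<lambda>n. u n - v n) \<le> \<epsilon>)"
proof -
  obtain v where v: "convex_seq v" and w: "lipschitz_const (\<lambda>n. u n - v n) (\<epsilon> / 2)"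
    using eps_convex_seq_decomposition assms by (metis less_imp_le)
  obtain g where g: "convex_on {0..} g" "\<And>n. g (real n) = v n"
    using convex_seq_extension[OF v] by blast
  have "\<bar>(u i - v i) - (u j - v j)\<bar> \<le> \<epsilon> / 2 * dist (real i) (real j)" for i j
    using w by (simp add: lipschitz_const_def dist_real_def)
  then obtain h where h: "\<And>x y. \<bar>h x - h y\<bar> \<le> \<epsilon> / 2 * dist x y" "\<And>n. h (real n) = u n - v n"
    using lipschitz_extension_real[of "\<lambda>n. u n - v n" "\<epsilon> / 2" real] assms(1) by auto
  have "eps_convex_fun \<epsilon> (\<lambda>x. g x + h x)"
    using eps_convex_fun_convex_plus_lipschitz[OF g(1)] h(1) by (simp add: dist_real_def)
  moreover have "g (real n) + h (real n) = u n" for n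
    by (simp add: g(2) h(2))
  moreover have "lipschitz_modulus (\<lambda>n. u n - v n) \<le> \<epsilon>"
    using lipschitz_modulus_le[OF w] assms(1) by linarith
  ultimately show ?thesis
    using v w unfolding lipschitz_seq_def by blast
qed

end
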